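(* Let $m,n\ge 1$ and let $G$ be a bridge sum (at any two vertices, one from each graph) of a tree on $m$ vertices and the complete graph on $n$ vertices. Then all orbits of toric promotion on $G$ have length $(m+n)(m+n-1)$.
   Context: Toric promotion. Let $G=(V,E)$ be a finite simple graph (undirected, no loops, no multiple edges) on $N$ vertices. A labeling of $G$ is a bijection $\sigma:V\to\mathbb{Z}/N\mathbb{Z}=\{1,\dots,N\}$ (addition modulo $N$). A state is a pair $(\sigma,i)$ with $\sigma$ a labeling of $G$ and $i\in\mathbb{Z}/N\mathbb{Z}$; $\Omega_G$ is the set of all states. Toric promotion is the map $\mathrm{TPro}:\Omega_G\to\Omega_G$ given by $\mathrm{TPro}(\sigma,i)=(\sigma,i+1)$ if $\{\sigma^{-1}(i),\sigma^{-1}(i+1)\}\in E$, and $\mathrm{TPro}(\sigma,i)=((i,i+1)\circ\sigma,\,i+1)$ otherwise, where $(i,i+1)$ is the permutation of $\mathbb{Z}/N\mathbb{Z}$ swapping $i$ and $i+1$. It is a bijection of $\Omega_G$. The length of the orbit containing $(\sigma,i)$ is the least $L\ge 1$ with $\mathrm{TPro}^L(\sigma,i)=(\sigma,i)$. Bridge sum. For graphs $G_1=(V_1,E_1)$, $G_2=(V_2,E_2)$ with disjoint vertex sets and vertices $v_1\in V_1$, $v_2\in V_2$, the bridge sum of $G_1$ and $G_2$ at $v_1$ and $v_2$ is the graph with vertex set $V_1\cup V_2$ and edge set $E_1\cup E_2\cup\{\{v_1,v_2\}\}$. *)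

theory Defs
  imports Main "HOL-Library.FuncSet" "HOL-Combinatorics.Transposition"
begin

record 'a graph =
  verts :: "'a set"
  edges :: "'a set set"

definition simple_graph :: "'a graph \<Rightarrow> bool" where
  "simple_graph G \<longleftrightarrow> finite (verts G) \<and> (\<forall>e\<in>edges G. e \<subseteq> verts G \<and> card e = 2)"

definition connected_graph :: "'a graph \<Rightarrow> bool" where
  "connected_graph G \<longleftrightarrow> verts G \<noteq> {} \<and>
     (\<forall>u\<in>verts G. \<forall>v\<in>verts G. (u, v) \<in> {(x, y). {x, y} \<in> edges G}\<^sup>*)"

definition is_cycle :: "'a graph \<Rightarrow> 'a list \<Rightarrow> bool" where
  "is_cycle G vs \<longleftrightarrow> 3 \<le> length vs \<and> distinct vs \<and> set vs \<subseteq> verts G \<and>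
     (\<forall>k<length vs. {vs ! k, vs ! (Suc k mod length vs)} \<in> edges G)"

definition is_tree :: "'a graph \<Rightarrow> bool" where
  "is_tree G \<longleftrightarrow> simple_graph G \<and> connected_graph G \<and> (\<nexists>vs. is_cycle G vs)"

definition is_complete :: "'a graph \<Rightarrow> bool" where
  "is_complete G \<longleftrightarrow> simple_graph G \<and>
     (\<forall>u\<in>verts G. \<forall>v\<in>verts G. u \<noteq> v \<longrightarrow> {u, v} \<in> edges G)"

text \<open>The two graphs are meant to have disjoint vertex sets, with \<open>v1\<close> in the first and
  \<open>v2\<close> in the second.\<close>
definition bridge_sum :: "'a graph \<Rightarrow> 'a graph \<Rightarrow> 'a \<Rightarrow> 'a \<Rightarrow> 'a graph" where
  "bridge_sum G1 G2 v1 v2 =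
     \<lparr>verts = verts G1 \<union> verts G2, edges = edges G1 \<union> edges G2 \<union> {{v1, v2}}\<rparr>"

text \<open>The integers modulo \<open>N\<close> are represented by \<open>{1..N}\<close>; on these representatives
  \<open>cyc_succ N\<close> is addition of 1 modulo \<open>N\<close>, so that \<open>N\<close> is sent to \<open>1\<close>.\<close>
definition cyc_succ :: "nat \<Rightarrow> nat \<Rightarrow> nat" where
  "cyc_succ N i = i mod N + 1"

text \<open>Labelings are extensional (equal to \<open>undefined\<close> outside the vertex set), so that equality
  of HOL functions is equality of labelings.\<close>
definition labelings :: "'a graph \<Rightarrow> ('a \<Rightarrow> nat) set" where
  "labelings G = {\<sigma> \<in> extensional (verts G). bij_betw \<sigma> (verts G) {1..card (verts G)}}"

definition states :: "'a graph \<Rightarrow> (('a \<Rightarrow> nat) \<times> nat) set" where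
  "states G = labelings G \<times> {1..card (verts G)}"

text \<open>\<open>compose V g \<sigma>\<close> is \<open>g \<circ> \<sigma>\<close> on \<open>V\<close> and \<open>undefined\<close> elsewhere.\<close>
definition TPro :: "'a graph \<Rightarrow> ('a \<Rightarrow> nat) \<times> nat \<Rightarrow> ('a \<Rightarrow> nat) \<times> nat" where
  "TPro G = (\<lambda>(\<sigma>, i).
     let j = cyc_succ (card (verts G)) i in
     if {inv_into (verts G) \<sigma> i, inv_into (verts G) \<sigma> j} \<in> edges G
     then (\<sigma>, j)
     else (compose (verts G) (transpose i j) \<sigma>, j))"

definition orbit_length :: "('s \<Rightarrow> 's) \<Rightarrow> 's \<Rightarrow> nat" where
  "orbit_length f x = (LEAST L. 1 \<le> L \<and> (f ^^ L) x = x)"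

lemma cyc_succ_mem: "i \<in> {1..N} \<Longrightarrow> cyc_succ N i \<in> {1..N}"
  by (auto simp: cyc_succ_def Suc_le_eq)

lemma cyc_succ_inj: "inj_on (cyc_succ N) {1..N}"
proof (rule inj_onI)
  fix i j assume "i \<in> {1..N}" "j \<in> {1..N}" "cyc_succ N i = cyc_succ N j"
  then show "i = j"
    by (cases "i = N"; cases "j = N") (auto simp: cyc_succ_def)
qed

lemma compose_transpose_labelings:
  assumes "\<sigma> \<in> labelings G" "i \<in> {1..card (verts G)}" "j \<in> {1..card (verts G)}"
  shows "compose (verts G) (transpose i j) \<sigma> \<in> labelings G"
proof -
  have "bij_betw (transpose i j) {1..card (verts G)} {1..card (verts G)}"
    using assms(2,3) by (simp add: bij_betw_transpose_iff)
  then have "bij_betw (compose (verts G) (transpose i j) \<sigma>) (verts G) {1..card (verts G)}"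
    using assms(1) bij_betw_compose unfolding labelings_def by blast
  then show ?thesis
    by (simp add: labelings_def compose_def)
qed

lemma compose_transpose_twice:
  assumes "\<sigma> \<in> labelings G"
  shows "compose (verts G) (transpose i j) (compose (verts G) (transpose i j) \<sigma>) = \<sigma>"
  using assms by (auto simp: labelings_def compose_def extensional_def)

lemma inv_into_compose_transpose:
  assumes \<sigma>: "\<sigma> \<in> labelings G" and ij: "i \<in> {1..card (verts G)}" "j \<in> {1..card (verts G)}"
  shows "inv_into (verts G) (compose (verts G) (transpose i j) \<sigma>) i = inv_into (verts G) \<sigma> j"
proof (rule inv_into_f_eq)
  show "inj_on (compose (verts G) (transpose i j) \<sigma>) (verts G)"
    using compose_transpose_labelings[OF assms] by (auto simp: labelings_def bij_betw_def)
  have im: "j \<in> \<sigma> ` verts G"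
    using \<sigma> ij by (auto simp: labelings_def bij_betw_def)
  then show "inv_into (verts G) \<sigma> j \<in> verts G"
    by (rule inv_into_into)
  then show "compose (verts G) (transpose i j) \<sigma> (inv_into (verts G) \<sigma> j) = i"
    using im by (simp add: compose_def f_inv_into_f)
qed

lemma TPro_bij_betw:
  assumes "simple_graph G"
  shows "bij_betw (TPro G) (states G) (states G)"
proof -
  let ?V = "verts G" and ?N = "card (verts G)"
  have "labelings G \<subseteq> ?V \<rightarrow>\<^sub>E {1..?N}"
    by (auto simp: labelings_def bij_betw_def PiE_def)
  moreover have "finite (?V \<rightarrow>\<^sub>E {1..?N})"
    using assms by (intro finite_PiE) (auto simp: simple_graph_def)
  ultimately have fin: "finite (states G)"
    unfolding states_def using finite_subset by blast
  have into: "TPro G ` states G \<subseteq> states G"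
    using cyc_succ_mem compose_transpose_labelings
    by (fastforce simp: TPro_def states_def Let_def)
  have "inj_on (TPro G) (states G)"
  proof (rule inj_onI, clarify)
    fix \<sigma> i \<tau> k
    assume s: "(\<sigma>, i) \<in> states G" and t: "(\<tau>, k) \<in> states G"
      and eq: "TPro G (\<sigma>, i) = TPro G (\<tau>, k)"
    have "cyc_succ ?N i = cyc_succ ?N k"
      using eq by (auto simp: TPro_def Let_def split: if_splits)
    then have k: "k = i"
      using s t cyc_succ_inj[THEN inj_onD, of _ i k] by (auto simp: states_def)
    define j where "j = cyc_succ ?N i"
    have ij: "i \<in> {1..?N}" "j \<in> {1..?N}" and l: "\<sigma> \<in> labelings G" "\<tau> \<in> labelings G"
      using s t cyc_succ_mem unfolding j_def states_def by blast+
    have edge: "{inv_into ?V (compose ?V (transpose i j) \<rho>) i, inv_into ?V (compose ?V (transpose i j) \<rho>) j}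
        = {inv_into ?V \<rho> i, inv_into ?V \<rho> j}" if "\<rho> \<in> labelings G" for \<rho>
      using inv_into_compose_transpose[OF that ij]
        inv_into_compose_transpose[OF that ij(2,1)]
      by (auto simp: transpose_commute)
    let ?s = "\<lambda>\<rho>. compose ?V (transpose i j) \<rho>"
    have eq': "(if {inv_into ?V \<sigma> i, inv_into ?V \<sigma> j} \<in> edges G then \<sigma> else ?s \<sigma>) =
        (if {inv_into ?V \<tau> i, inv_into ?V \<tau> j} \<in> edges G then \<tau> else ?s \<tau>)"
      using eq by (simp add: k TPro_def Let_def flip: j_def split: if_splits)
    have "\<sigma> = \<tau>"
      using eq' edge[OF l(1)] edge[OF l(2)]
        compose_transpose_twice[OF l(1), of i j] compose_transpose_twice[OF l(2), of i j]
      by (smt (verit))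
    with k show "\<sigma> = \<tau> \<and> i = k" by simp
  qed
  with into fin show ?thesis
    by (simp add: bij_betw_def endo_inj_surj)
qed

lemma bridge_sum_simple_graph:
  assumes "simple_graph G1" "simple_graph G2" "verts G1 \<inter> verts G2 = {}"
    and "v1 \<in> verts G1" "v2 \<in> verts G2"
  shows "simple_graph (bridge_sum G1 G2 v1 v2)"
  using assms by (auto simp: simple_graph_def bridge_sum_def card_insert_if)

end

theory Submission
  imports Defs "HOL-Library.Transitive_Closure_Table"
begin

text \<open>Read the vertices of a state \<open>(\<sigma>, i)\<close> cyclically, starting from the label \<open>i\<close>. The first vertex
  \<open>u\<close> is carried around the circle formed by the other \<open>N - 1\<close> vertices; when it meets a
  neighbour, the two are exchanged and the neighbour is carried on. If \<open>u\<close> is a vertex of the tree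
  and is exchanged with a neighbour \<open>x\<close>, then the component \<open>B\<close> of \<open>x\<close> in \<open>G - u\<close> is toured as in a
  depth-first search: after \<open>(N - 1) |B|\<close> steps \<open>x\<close> is exchanged with \<open>u\<close> again and every vertex
  is back in its place. For a component inside the tree this is induction on \<open>|B|\<close>; for the complete
  graph, each trip around the circle rotates its vertices by one, so that \<open>n\<close> trips restore them.
  Summed over the components of \<open>G - u\<close>, the tour from \<open>u\<close> takes
  \<open>(N - 1) (1 + (N - 1)) = N (N - 1)\<close> steps. It does not return to its
  initial state earlier, because whenever \<open>u\<close> is carried, the vertex it meets next shows how much
  of the tour has been completed.\<close>

section \<open>Carrying a vertex around the circle\<close>

text \<open>The time interval is half open, so consecutive runs concatenate without overlap and a
  run may end in a state that violates \<open>P\<close>, as the tour in \<open>first_return\<close>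
  does when it closes.\<close>

definition runs :: "('s \<Rightarrow> 's) \<Rightarrow> ('s \<Rightarrow> bool) \<Rightarrow> nat \<Rightarrow> 's \<Rightarrow> 's \<Rightarrow> bool" where
  "runs f P a x y \<longleftrightarrow> (f ^^ a) x = y \<and> (\<forall>t<a. P ((f ^^ t) x))"

lemma runs_0: "runs f P 0 x x"
  by (simp add: runs_def)

lemma runs_1: "P x \<Longrightarrow> f x = y \<Longrightarrow> runs f P 1 x y"
  by (simp add: runs_def)

lemma runs_trans:
  assumes "runs f P a x y" "runs f P b y z"
  shows "runs f P (a + b) x z"
proof -
  have shift: "(f ^^ (a + t)) x = (f ^^ t) y" for t
    using assms(1) by (simp add: runs_def add.commute[of a] funpow_add)
  have "P ((f ^^ t) x)" if "t < a + b" for t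
  proof (cases "t < a")
    case True
    then show ?thesis using assms(1) by (simp add: runs_def)
  next
    case False
    then have "t = a + (t - a)" "t - a < b" using that by auto
    then show ?thesis using assms(2) shift by (metis runs_def)
  qed
  then show ?thesis using assms(2) shift by (simp add: runs_def)
qed

lemma runs_mono: "runs f P a x y \<Longrightarrow> (\<And>s. P s \<Longrightarrow> Q s) \<Longrightarrow> runs f Q a x y"
  by (simp add: runs_def)

text \<open>Toric promotion seen from the moving label: the head has label i, the next entry i + 1.
  Both cases re-read from i + 1, so an edge merely rotates the list, while a swap of labels keeps
  \<open>u\<close> in front and sends \<open>w\<close> to the end.\<close>

fun step :: "('a \<Rightarrow> 'a \<Rightarrow> bool) \<Rightarrow> 'a list \<Rightarrow> 'a list" where
  "step E (u # w # ws) = (if E u w then w # ws @ [u] else u # ws @ [w])"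
| "step E ws = ws"

text \<open>In \<open>x # ws @ [u]\<close> the vertex \<open>x\<close> has just been exchanged with \<open>u\<close>; in \<open>u # ws @ [x]\<close> it has
  just been exchanged back.\<close>
definition excursion :: "('a \<Rightarrow> 'a \<Rightarrow> bool) \<Rightarrow> 'a set \<Rightarrow> 'a \<Rightarrow> 'a \<Rightarrow> 'a set \<Rightarrow> bool" where
  "excursion E V x u B \<longleftrightarrow> u \<notin> B \<and>
     (\<forall>ws. distinct (x # u # ws) \<longrightarrow> set (x # u # ws) = V \<longrightarrow>
       runs (step E) (\<lambda>s. hd s \<in> B) (card B * (card V - 1)) (x # ws @ [u]) (u # ws @ [x]))"

text \<open>A non-neighbour is passed in one step; a neighbour \<open>x\<close> is exchanged in one
  step, and its excursion then undoes the exchange with \<open>x\<close> left behind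
  \<open>u\<close>. Vertices already passed collect at the end of \<open>ys\<close>. The clause on
  \<open>s ! 1\<close> later excludes an early return.\<close>

lemma sweep:
  assumes "distinct (u # xs @ ys)" "set (u # xs @ ys) = V"
    and "\<And>x. x \<in> set xs \<Longrightarrow> E u x \<Longrightarrow> excursion E V x u (B x)"
  shows "runs (step E)
    (\<lambda>s. hd s \<in> insert u (\<Union>x\<in>{x \<in> set xs. E u x}. B x) \<and> (hd s = u \<longrightarrow> s ! 1 \<in> set xs))
    (length xs + (card V - 1) * (\<Sum>x\<in>{x \<in> set xs. E u x}. card (B x)))
    (u # xs @ ys) (u # ys @ xs)"
  using assms
proof (induction xs arbitrary: ys)
  case Nil
  then show ?case by (simp add: runs_0)
next
  case (Cons x xs)
  let ?P = "\<lambda>s. hd s \<in> insert u (\<Union>z\<in>{z \<in> set (x # xs). E u z}. B z) \<and>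
    (hd s = u \<longrightarrow> s ! 1 \<in> set (x # xs))"
  have rest: "runs (step E) ?P
      (length xs + (card V - 1) * (\<Sum>x\<in>{x \<in> set xs. E u x}. card (B x)))
      (u # xs @ (ys @ [x])) (u # (ys @ [x]) @ xs)"
    by (rule runs_mono[OF Cons.IH[of "ys @ [x]"]]) (use Cons.prems in auto)
  show ?case
  proof (cases "E u x")
    case False
    then have "{z \<in> set (x # xs). E u z} = {z \<in> set xs. E u z}" by auto
    moreover have "runs (step E) ?P 1 (u # (x # xs) @ ys) (u # xs @ ys @ [x])"
      by (rule runs_1) (use False in auto)
    ultimately show ?thesis
      using runs_trans[OF _ rest, of 1] by simp
  next
    case True
    then have set: "{z \<in> set (x # xs). E u z} = insert x {z \<in> set xs. E u z}" by auto
    have "x \<notin> {z \<in> set xs. E u z}" using Cons.prems(1) by auto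
    then have sum: "(\<Sum>x\<in>{z \<in> set (x # xs). E u z}. card (B x)) =
        card (B x) + (\<Sum>x\<in>{x \<in> set xs. E u x}. card (B x))"
      unfolding set by (subst sum.insert) auto
    have ex: "excursion E V x u (B x)" using Cons.prems(3) True by simp
    have "runs (step E) ?P 1 (u # (x # xs) @ ys) (x # (xs @ ys) @ [u])"
      by (rule runs_1) (use True in auto)
    moreover have "distinct (x # u # xs @ ys)" "set (x # u # xs @ ys) = V"
      using Cons.prems by auto
    with ex have r: "runs (step E) (\<lambda>s. hd s \<in> B x) (card (B x) * (card V - 1))
        (x # (xs @ ys) @ [u]) (u # (xs @ ys) @ [x])"
      unfolding excursion_def by blast
    have "runs (step E) ?P (card (B x) * (card V - 1))
        (x # (xs @ ys) @ [u]) (u # (xs @ ys) @ [x])"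
      by (rule runs_mono[OF r]) (use ex True in \<open>auto simp: excursion_def\<close>)
    ultimately have "runs (step E) ?P (1 + card (B x) * (card V - 1))
        (u # (x # xs) @ ys) (u # (xs @ ys) @ [x])"
      by (rule runs_trans)
    with rest have "runs (step E) ?P (1 + card (B x) * (card V - 1) +
        (length xs + (card V - 1) * (\<Sum>x\<in>{x \<in> set xs. E u x}. card (B x))))
        (u # (x # xs) @ ys) (u # (ys @ [x]) @ xs)"
      by (simp only: append_assoc runs_trans)
    then show ?thesis
      unfolding sum by (simp add: distrib_left mult.commute add_ac)
  qed
qed

section \<open>Branches at a vertex\<close>

definition avoiding :: "('a \<Rightarrow> 'a \<Rightarrow> bool) \<Rightarrow> 'a \<Rightarrow> ('a \<times> 'a) set" where
  "avoiding E x = {(a, b). E a b \<and> a \<noteq> x \<and> b \<noteq> x}"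

text \<open>For symmetric \<open>E\<close> and \<open>x\<close> other than \<open>u\<close>, this is
  the connected component of \<open>x\<close> after deletion of \<open>u\<close>.\<close>

definition branch :: "('a \<Rightarrow> 'a \<Rightarrow> bool) \<Rightarrow> 'a \<Rightarrow> 'a \<Rightarrow> 'a set" where
  "branch E u x = (avoiding E u)\<^sup>* `` {x}"

lemma branch_self: "x \<in> branch E u x"
  by (simp add: branch_def)

lemma not_in_branch:
  assumes "x \<noteq> u"
  shows "u \<notin> branch E u x"
proof
  assume "u \<in> branch E u x"
  then have "(x, u) \<in> (avoiding E u)\<^sup>*" by (simp add: branch_def)
  then show False using assms by (cases rule: rtranclE) (auto simp: avoiding_def)
qed

lemma branch_step:
  "y \<in> branch E u x \<Longrightarrow> E y z \<Longrightarrow> y \<noteq> u \<Longrightarrow> z \<noteq> u \<Longrightarrow> z \<in> branch E u x"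
  unfolding branch_def avoiding_def by (auto intro: rtrancl_into_rtrancl)

lemma branch_induct [consumes 1, case_names base step]:
  assumes "z \<in> branch E u x" and "P x"
    and "\<And>y z. y \<in> branch E u x \<Longrightarrow> P y \<Longrightarrow> E y z \<Longrightarrow> y \<noteq> u \<Longrightarrow> z \<noteq> u \<Longrightarrow> P z"
  shows "P z"
proof -
  have "(x, z) \<in> (avoiding E u)\<^sup>*" using assms(1) by (simp add: branch_def)
  then show ?thesis
  proof (induction rule: rtrancl_induct)
    case base
    then show ?case by (rule assms(2))
  next
    case (step y z)
    then show ?case
      using assms(3)[of y z] by (simp add: branch_def avoiding_def)
  qed
qed

lemma branch_sym:
  assumes "symp E" "z \<in> branch E u x"
  shows "branch E u z = branch E u x"
proof -
  have "sym (avoiding E u)"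
    using assms(1) by (auto simp: sym_def symp_def avoiding_def)
  then have "sym ((avoiding E u)\<^sup>*)" by (rule sym_rtrancl)
  then show ?thesis
    using assms(2) unfolding branch_def sym_def by (blast intro: rtrancl_trans)
qed

section \<open>Invariants of \<open>step\<close> and patterns of clique vertices\<close>

lemma funpow_step_set: "set ((step E ^^ t) xs) = set xs"
proof (induction t)
  case (Suc t)
  have "set (step E ys) = set ys" for ys
    by (cases "(E, ys)" rule: step.cases) auto
  with Suc show ?case by simp
qed simp

lemma funpow_step_distinct: "distinct ((step E ^^ t) xs) = distinct xs"
proof (induction t)
  case (Suc t)
  have "distinct (step E ys) = distinct ys" for ys
    by (cases "(E, ys)" rule: step.cases) auto
  with Suc show ?case by simp
qed simp

text \<open>\<open>ws\<close> serves as a pattern of slots. This separates the order of the vertices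
  of \<open>K\<close> from the slots they occupy, so that moving them along the slots becomes an
  operation on \<open>ks\<close> alone.\<close>

fun refill :: "'a set \<Rightarrow> 'a list \<Rightarrow> 'a list \<Rightarrow> 'a list" where
  "refill K ks [] = []"
| "refill K ks (w # ws) = (if w \<in> K then hd ks # refill K (tl ks) ws else w # refill K ks ws)"

lemma refill_filter: "refill K (filter (\<lambda>x. x \<in> K) ws) ws = ws"
  by (induction ws) auto

section \<open>Tours of a graph with a bridge\<close>

text \<open>\<open>separating\<close> stands in for acyclicity: deleting a vertex of
  \<open>T\<close> puts its neighbours into different components, also when one of them is
  \<open>v2\<close>.\<close>

locale bridge_walk =
  fixes E :: "'a \<Rightarrow> 'a \<Rightarrow> bool" and V T K :: "'a set" and v1 v2 :: 'a
  assumes finite_V: "finite V"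
    and V_eq: "V = T \<union> K" and disjoint: "T \<inter> K = {}"
    and v1: "v1 \<in> T" and v2: "v2 \<in> K"
    and E_sym: "symp E" and E_irrefl: "\<not> E x x"
    and E_V: "E x y \<Longrightarrow> x \<in> V \<and> y \<in> V"
    and connected: "x \<in> V \<Longrightarrow> y \<in> V \<Longrightarrow> E\<^sup>*\<^sup>* x y"
    and complete: "x \<in> K \<Longrightarrow> y \<in> K \<Longrightarrow> x \<noteq> y \<Longrightarrow> E x y"
    and bridge: "x \<in> T \<Longrightarrow> y \<in> K \<Longrightarrow> E x y \<longleftrightarrow> x = v1 \<and> y = v2"
    and separating: "x \<in> T \<Longrightarrow> E x y \<Longrightarrow> E x z \<Longrightarrow> y \<noteq> z \<Longrightarrow> z \<notin> branch E x y"
begin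

abbreviation "N \<equiv> card V"

lemma E_commute: "E x y \<longleftrightarrow> E y x"
  using E_sym by (auto simp: symp_def)

section \<open>The excursion through the complete graph\<close>

text \<open>Since \<open>v1\<close> is not in \<open>ws\<close>, the carried vertex is adjacent to
  precisely the vertices of \<open>K\<close> that it meets. Each such meeting leaves it in the slot
  of the vertex that takes over, so the vertices of \<open>K\<close> move on by one slot and
  \<open>tl ks\<close> becomes \<open>butlast ks\<close>.\<close>

lemma sweep_complete:
  assumes "ks \<noteq> []" "length ks = Suc (length (filter (\<lambda>x. x \<in> K) ws))"
    and "distinct ks" "set ks \<subseteq> K" "v1 \<notin> set ws"
  shows "runs (step E) (\<lambda>s. hd s \<in> K) (length ws)
    (hd ks # refill K (tl ks) ws @ zs) (last ks # zs @ refill K (butlast ks) ws)"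
  using assms
proof (induction ws arbitrary: ks zs)
  case Nil
  then show ?case by (cases ks) (auto simp: runs_0)
next
  case (Cons w ws)
  obtain k ks' where ks: "ks = k # ks'" using Cons.prems(1) by (cases ks) auto
  show ?case
  proof (cases "w \<in> K")
    case True
    then obtain l ks'' where ks': "ks' = l # ks''" using Cons.prems(2) ks by (cases ks') auto
    have "E k l" using Cons.prems ks ks' by (intro complete) auto
    then have "runs (step E) (\<lambda>s. hd s \<in> K) 1
        (hd ks # refill K (tl ks) (w # ws) @ zs) (hd ks' # refill K (tl ks') ws @ (zs @ [k]))"
      using Cons.prems(4) ks ks' True by (intro runs_1) auto
    moreover have "runs (step E) (\<lambda>s. hd s \<in> K) (length ws)
        (hd ks' # refill K (tl ks') ws @ (zs @ [k]))
        (last ks' # (zs @ [k]) @ refill K (butlast ks') ws)"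
      by (rule Cons.IH) (use Cons.prems ks ks' True in auto)
    ultimately show ?thesis
      using runs_trans True ks ks' by fastforce
  next
    case False
    have "\<not> E k w"
      using False Cons.prems ks bridge[of w k] E_commute[of k w] E_V[of k w] V_eq by auto
    then have "runs (step E) (\<lambda>s. hd s \<in> K) 1
        (hd ks # refill K (tl ks) (w # ws) @ zs) (hd ks # refill K (tl ks) ws @ (zs @ [w]))"
      using Cons.prems(4) ks False by (intro runs_1) auto
    moreover have "runs (step E) (\<lambda>s. hd s \<in> K) (length ws)
        (hd ks # refill K (tl ks) ws @ (zs @ [w]))
        (last ks # (zs @ [w]) @ refill K (butlast ks) ws)"
      by (rule Cons.IH) (use Cons.prems ks False in auto)
    ultimately show ?thesis
      using runs_trans False by fastforce
  qed
qed

text \<open>While \<open>v2\<close> is not the vertex that meets \<open>v1\<close>, a trip around the circle undoes one rotation of \<open>ks\<close>.\<close>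
lemma rounds_complete:
  assumes "i < length ks" "length ks = Suc (length (filter (\<lambda>x. x \<in> K) ws))"
    and "distinct ks" "set ks \<subseteq> K" "hd ks = v2" "v1 \<notin> set ws"
  shows "runs (step E) (\<lambda>s. hd s \<in> K) (i * Suc (length ws))
    (hd (rotate i ks) # v1 # refill K (tl (rotate i ks)) ws) (hd ks # v1 # refill K (tl ks) ws)"
  using assms(1)
proof (induction i)
  case 0
  then show ?case by (simp add: runs_0)
next
  case (Suc i)
  let ?k = "rotate i ks" and ?l = "rotate (Suc i) ks"
  have ne: "ks \<noteq> []" using assms(2) by auto
  \<comment> \<open>\<open>v2\<close> is entry 0 of the distinct list \<open>ks\<close>, so after
    \<open>Suc i\<close> rotations another vertex of \<open>K\<close> faces \<open>v1\<close> and
    passes it.\<close>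
  have hd: "hd ?l = ks ! Suc i" using Suc.prems ne by (subst hd_rotate_conv_nth) auto
  then have "hd ?l \<noteq> v2"
    using assms(3,5) Suc.prems ne nth_eq_iff_index_eq[of ks "Suc i" 0] by (auto simp: hd_conv_nth)
  moreover have K: "hd ?l \<in> K" using hd assms(4) Suc.prems by auto
  ultimately have "\<not> E (hd ?l) v1" using bridge v1 E_commute by blast
  then have "runs (step E) (\<lambda>s. hd s \<in> K) 1
      (hd ?l # v1 # refill K (tl ?l) ws) (hd ?l # refill K (tl ?l) ws @ [v1])"
    using K by (intro runs_1) auto
  moreover have "runs (step E) (\<lambda>s. hd s \<in> K) (length ws)
      (hd ?l # refill K (tl ?l) ws @ [v1]) (last ?l # [v1] @ refill K (butlast ?l) ws)"
    by (rule sweep_complete) (use assms ne in auto)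
  moreover have "last ?l = hd ?k" "butlast ?l = tl ?k"
    using ne by (cases ?k; simp)+
  ultimately have "runs (step E) (\<lambda>s. hd s \<in> K) (1 + length ws)
      (hd ?l # v1 # refill K (tl ?l) ws) (hd ?k # v1 # refill K (tl ?k) ws)"
    using runs_trans by fastforce
  from runs_trans[OF this Suc.IH] show ?case using Suc.prems by (simp add: add_ac)
qed

lemma length_filter_complete:
  assumes "distinct (c # v1 # ws)" "set (c # v1 # ws) = V" "c \<in> K"
  shows "length (filter (\<lambda>x. x \<in> K) (c # ws)) = card K"
proof -
  have "set (filter (\<lambda>x. x \<in> K) (c # ws)) = K"
    using assms V_eq v1 disjoint by auto
  then show ?thesis
    using assms(1) distinct_card[of "filter (\<lambda>x. x \<in> K) (c # ws)"] by simp
qed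

lemma length_eq: "distinct xs \<Longrightarrow> set xs = V \<Longrightarrow> length xs = N"
  using distinct_card by fastforce

text \<open>The first sweep ends when the carried vertex faces \<open>v1\<close>, with the vertices
  of \<open>K\<close> displaced by one slot. Then n - 1 full trips bring \<open>v2\<close> back to
  face \<open>v1\<close>, and one exchange closes the excursion: (N - 2) + (n - 1)(N - 1) + 1 = n (N
  - 1), where n is \<open>card K\<close>.\<close>

lemma excursion_complete: "excursion E V v2 v1 K"
  unfolding excursion_def
proof (intro conjI allI impI)
  show "v1 \<notin> K" using v1 disjoint by auto
  fix ws assume d: "distinct (v2 # v1 # ws)" and s: "set (v2 # v1 # ws) = V"
  let ?f = "filter (\<lambda>x. x \<in> K) ws"
  let ?ks = "v2 # ?f"
  \<comment> \<open>One rotation short of a full turn: the order in which the first sweep leaves the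
    vertices of \<open>K\<close>.\<close>
  let ?r = "rotate (length ?f) ?ks"
  have len: "Suc (length ?f) = card K" using length_filter_complete[OF d s v2] v2 by simp
  have N: "N - 1 = Suc (length ws)" using length_eq[OF d s] by simp
  have sub: "set ?ks \<subseteq> K" "distinct ?ks" "v1 \<notin> set ws" using v2 d by auto
  have ends: "rotate1 ?r = ?ks"
    using rotate_id[of "length ?ks" ?ks] by simp
  then have r: "hd ?r = last ?ks" "tl ?r = butlast ?ks"
    by (metis butlast_snoc last_snoc list.discI rotate1_hd_tl rotate1_is_Nil_conv)+
  have "runs (step E) (\<lambda>s. hd s \<in> K) (length ws) (v2 # ws @ [v1])
      (hd ?r # v1 # refill K (tl ?r) ws)"
    using sweep_complete[of ?ks ws "[v1]"] sub r by (simp add: refill_filter)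
  moreover have "runs (step E) (\<lambda>s. hd s \<in> K) (length ?f * Suc (length ws))
      (hd ?r # v1 # refill K (tl ?r) ws) (v2 # v1 # ws)"
    using rounds_complete[of "length ?f" ?ks ws] sub by (simp add: refill_filter)
  moreover have "runs (step E) (\<lambda>s. hd s \<in> K) 1 (v2 # v1 # ws) (v1 # ws @ [v2])"
    using v2 bridge[OF v1 v2] E_commute by (intro runs_1) auto
  ultimately have "runs (step E) (\<lambda>s. hd s \<in> K)
      (length ws + (length ?f * Suc (length ws) + 1)) (v2 # ws @ [v1]) (v1 # ws @ [v2])"
    by (blast intro: runs_trans)
  moreover have "card K * (N - 1) = length ws + (length ?f * Suc (length ws) + 1)"
    unfolding N len[symmetric] by simp
  ultimately show "runs (step E) (\<lambda>s. hd s \<in> K) (card K * (N - 1)) (v2 # ws @ [v1]) (v1 # ws @ [v2])"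
    by simp
qed

text \<open>This leads an orbit from a carried vertex of \<open>K\<close> into the tree: sweep as
  far as \<open>v1\<close>, make full trips until \<open>v2\<close> is the vertex that faces
  \<open>v1\<close>, then exchange.\<close>

lemma reaches_v1:
  assumes "distinct (c # ws)" "set (c # ws) = V" "c \<in> K"
  shows "\<exists>t. hd ((step E ^^ t) (c # ws)) = v1"
proof -
  have "v1 \<in> set ws" using assms v1 disjoint V_eq by auto
  then obtain as bs where ws: "ws = as @ v1 # bs" by (meson split_list)
  let ?F = "c # filter (\<lambda>x. x \<in> K) as"
  define c' where "c' = last ?F"
  define zs where "zs = bs @ refill K (butlast ?F) as"
  have sub: "set (filter (\<lambda>x. x \<in> K) as) \<subseteq> K" by auto
  have r: "runs (step E) (\<lambda>s. hd s \<in> K) (length as) (c # ws) (c' # v1 # zs)"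
    using sweep_complete[of ?F as "v1 # bs"] assms ws sub
    unfolding c'_def zs_def ws by (simp add: refill_filter)
  have d: "distinct (c' # v1 # zs)" and s: "set (c' # v1 # zs) = V"
    using funpow_step_distinct[of "length as" E "c # ws"] funpow_step_set[of "length as" E "c # ws"]
      assms r by (simp_all add: runs_def)
  have c': "c' \<in> K" unfolding c'_def using assms(3) last_in_set[of ?F] by auto
  define ks where "ks = c' # filter (\<lambda>x. x \<in> K) zs"
  have "v2 \<in> set ks" using s c' v2 V_eq v1 disjoint by (auto simp: ks_def)
  then obtain j where j: "j < length ks" "ks ! j = v2" by (auto simp: in_set_conv_nth)
  \<comment> \<open>\<open>j\<close> rotations bring \<open>v2\<close> to the front, whereas each
    trip undoes a rotation, so the number of trips is -j modulo the length; the \<open>mod\<close>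
    covers \<open>j = 0\<close>.\<close>
  define i where "i = (length ks - j) mod length ks"
  have "(i + j) mod length ks = 0"
    using j(1) unfolding i_def by (simp add: mod_add_left_eq)
  then have rot: "rotate i (rotate j ks) = ks" by (simp add: rotate_rotate)
  have hd: "hd (rotate j ks) = v2" using j by (subst hd_rotate_conv_nth) auto
  have "runs (step E) (\<lambda>s. hd s \<in> K) (i * Suc (length zs))
      (hd ks # v1 # refill K (tl ks) zs)
      (hd (rotate j ks) # v1 # refill K (tl (rotate j ks)) zs)"
  proof -
    have "set ks \<subseteq> K" using c' by (auto simp: ks_def)
    moreover have "distinct ks" using d by (auto simp: ks_def)
    moreover have "length ks = Suc (length (filter (\<lambda>x. x \<in> K) zs))" by (simp add: ks_def)
    moreover have "i < length ks" using j(1) unfolding i_def by (intro mod_less_divisor) auto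
    ultimately show ?thesis
      using rounds_complete[of i "rotate j ks" zs] hd rot d by simp
  qed
  then have "runs (step E) (\<lambda>s. hd s \<in> K) (i * Suc (length zs))
      (c' # v1 # zs) (v2 # v1 # refill K (tl (rotate j ks)) zs)"
    unfolding hd by (simp add: ks_def refill_filter)
  from runs_trans[OF r this]
  have "hd (step E ((step E ^^ (length as + i * Suc (length zs))) (c # ws))) = v1"
    using bridge[OF v1 v2] E_commute by (simp add: runs_def)
  then show ?thesis by (metis funpow.simps(2) o_apply)
qed

lemma branch_complete: "branch E v1 v2 = K"
proof (intro equalityI subsetI)
  fix z assume "z \<in> branch E v1 v2"
  then show "z \<in> K"
  proof (induction rule: branch_induct)
    case base
    then show ?case by (rule v2)
  next
    case (step y z)
    then show ?case using E_V[of y z] V_eq bridge[of z y] E_commute[of y z] by auto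
  qed
next
  fix z assume "z \<in> K"
  then show "z \<in> branch E v1 v2"
    using complete[OF v2, of z] branch_step[OF branch_self, of E v2 z v1] branch_self[of v2 E v1]
      v1 v2 disjoint by (cases "z = v2") auto
qed

section \<open>Branches at vertices of the tree\<close>

lemma branch_subset: "x \<in> V \<Longrightarrow> branch E u x \<subseteq> V"
proof
  fix z assume "z \<in> branch E u x" "x \<in> V"
  then show "z \<in> V" by (induction rule: branch_induct) (auto dest: E_V)
qed

lemma branch_disjoint:
  assumes "x \<in> T" "E x y" "E x z" "y \<noteq> z"
  shows "branch E x y \<inter> branch E x z = {}"
proof (rule ccontr)
  assume "branch E x y \<inter> branch E x z \<noteq> {}"
  then have "branch E x y = branch E x z" using branch_sym[OF E_sym] by blast
  then show False using separating[OF assms] branch_self by metis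
qed

text \<open>By \<open>separating\<close>, \<open>u\<close> is outside every branch at
  \<open>x\<close> through another neighbour, so a walk there avoids \<open>u\<close> as well as
  \<open>x\<close>. Conversely, a walk avoiding \<open>u\<close> enters such a branch whenever it
  leaves \<open>x\<close>. The smaller branches support the induction in
  \<open>excursion_branch\<close>.\<close>

lemma branch_decompose:
  assumes "x \<in> T" "E x u"
  shows "branch E u x = insert x (\<Union>y\<in>{y. E x y \<and> y \<noteq> u}. branch E x y)"
proof (intro equalityI subsetI)
  fix z assume "z \<in> branch E u x"
  then show "z \<in> insert x (\<Union>y\<in>{y. E x y \<and> y \<noteq> u}. branch E x y)"
  proof (induction rule: branch_induct)
    case base
    then show ?case by simp
  next
    case (step y z)
    then show ?case using branch_self[of z E x] branch_step[of y E x _ z] by blast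
  qed
next
  fix z assume "z \<in> insert x (\<Union>y\<in>{y. E x y \<and> y \<noteq> u}. branch E x y)"
  then consider "z = x" | y where "E x y" "y \<noteq> u" "z \<in> branch E x y" by auto
  then show "z \<in> branch E u x"
  proof cases
    case 1
    then show ?thesis by (simp add: branch_self)
  next
    case 2
    have xu: "x \<noteq> u" using assms E_irrefl by auto
    have un: "u \<notin> branch E x y" using separating assms 2 by blast
    from 2(3) show ?thesis
    proof (induction rule: branch_induct)
      case base
      then show ?case using branch_step[OF branch_self] 2 xu by metis
    next
      case (step w z)
      have "z \<in> branch E x y" using step branch_step by metis
      then have "z \<noteq> u" "w \<noteq> u" using un step by auto
      then show ?case using step branch_step by metis
    qed
  qed
qed

lemma V_decompose:
  assumes "u \<in> T"
  shows "V = insert u (\<Union>y\<in>{y. E u y}. branch E u y)"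
proof (intro equalityI subsetI)
  fix z assume "z \<in> V"
  then have "E\<^sup>*\<^sup>* u z" using assms V_eq connected by auto
  then show "z \<in> insert u (\<Union>y\<in>{y. E u y}. branch E u y)"
  proof (induction rule: rtranclp_induct)
    case base
    then show ?case by simp
  next
    case (step y z)
    then show ?case using branch_self[of z E u] branch_step[of y E u _ z] by blast
  qed
next
  fix z assume "z \<in> insert u (\<Union>y\<in>{y. E u y}. branch E u y)"
  then show "z \<in> V" using assms V_eq branch_subset E_V by blast
qed

lemma finite_branch: "E x y \<Longrightarrow> finite (branch E u y)"
  using branch_subset finite_V E_V finite_subset by metis

text \<open>Branches through distinct neighbours are disjoint, and none contains \<open>x\<close>.
  The parameter \<open>Q\<close> covers both uses: excluding \<open>u\<close> for a single branch,
  and no restriction for the whole vertex set.\<close>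

lemma card_branches:
  assumes "x \<in> T"
  shows "card (insert x (\<Union>y\<in>{y. E x y \<and> Q y}. branch E x y)) =
    Suc (\<Sum>y\<in>{y. E x y \<and> Q y}. card (branch E x y))"
proof -
  have fin: "finite {y. E x y \<and> Q y}"
    using finite_V by (rule rev_finite_subset) (use E_V in blast)
  have "x \<notin> (\<Union>y\<in>{y. E x y \<and> Q y}. branch E x y)"
  proof
    assume "x \<in> (\<Union>y\<in>{y. E x y \<and> Q y}. branch E x y)"
    then obtain y where "E x y" "x \<in> branch E x y" by blast
    then show False using not_in_branch[of y x E] E_irrefl[of x] by auto
  qed
  moreover have "finite (\<Union>y\<in>{y. E x y \<and> Q y}. branch E x y)"
    using fin finite_branch by auto
  moreover have "card (\<Union>y\<in>{y. E x y \<and> Q y}. branch E x y) =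
      (\<Sum>y\<in>{y. E x y \<and> Q y}. card (branch E x y))"
    by (rule card_UN_disjoint) (use fin finite_branch branch_disjoint assms in auto)
  ultimately show ?thesis by simp
qed

section \<open>Tours from vertices of the tree\<close>

text \<open>After the exchange, \<open>x\<close> passes the N - 2 other vertices before it meets
  \<open>u\<close> again. The smaller branches are toured by the induction hypothesis, or by
  \<open>excursion_complete\<close> at the bridge. If their sizes sum to s, the time is (N - 2) + (N
  - 1) s + 1 = (N - 1)(s + 1).\<close>

lemma excursion_branch:
  assumes "x \<in> T" "E x u"
  shows "excursion E V x u (branch E u x)"
  using assms
proof (induction "card (branch E u x)" arbitrary: x u rule: less_induct)
  case less
  note dec = branch_decompose[OF less.prems]
  have fin: "finite (branch E u x)" using finite_branch less.prems E_commute by metis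
  have xu: "x \<noteq> u" using less.prems E_irrefl by auto
  have ex: "excursion E V y x (branch E x y)" if y: "E x y" "y \<noteq> u" for y
  proof (cases "y \<in> K")
    case True
    then show ?thesis using bridge less.prems y excursion_complete branch_complete by simp
  next
    case False
    have "branch E x y \<subset> branch E u x"
      using dec y not_in_branch[of y x E] E_irrefl by fastforce
    then show ?thesis
      using less.hyps[of x y] fin psubset_card_mono y False E_V V_eq E_commute by blast
  qed
  show ?case
    unfolding excursion_def
  proof (intro conjI allI impI)
    show "u \<notin> branch E u x" by (rule not_in_branch[OF xu])
    fix ws assume d: "distinct (x # u # ws)" and s: "set (x # u # ws) = V"
    have nb: "{y \<in> set ws. E x y} = {y. E x y \<and> y \<noteq> u}"
      using d s E_V E_irrefl by fastforce
    have "runs (step E) (\<lambda>s. hd s \<in> insert x (\<Union>y\<in>{y \<in> set ws. E x y}. branch E x y) \<and>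
        (hd s = x \<longrightarrow> s ! 1 \<in> set ws))
      (length ws + (card V - 1) * (\<Sum>y\<in>{y \<in> set ws. E x y}. card (branch E x y)))
      (x # ws @ [u]) (x # [u] @ ws)"
      by (rule sweep) (use d s ex in auto)
    then have "runs (step E) (\<lambda>s. hd s \<in> branch E u x)
      (length ws + (card V - 1) * (\<Sum>y\<in>{y \<in> set ws. E x y}. card (branch E x y)))
      (x # ws @ [u]) (x # [u] @ ws)"
      by (rule runs_mono) (simp add: dec nb)
    moreover have "runs (step E) (\<lambda>s. hd s \<in> branch E u x) 1 (x # [u] @ ws) (u # ws @ [x])"
      by (rule runs_1) (use less.prems branch_self in auto)
    ultimately have "runs (step E) (\<lambda>s. hd s \<in> branch E u x)
      (length ws + (card V - 1) * (\<Sum>y\<in>{y \<in> set ws. E x y}. card (branch E x y)) + 1)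
      (x # ws @ [u]) (u # ws @ [x])"
      by (rule runs_trans)
    moreover have N: "N - 1 = length ws + 1" using length_eq[OF d s] by simp
    have card: "card (branch E u x) = Suc (\<Sum>y\<in>{y \<in> set ws. E x y}. card (branch E x y))"
      unfolding dec nb using less.prems(1) by (rule card_branches)
    have "length ws + (N - 1) * (\<Sum>y\<in>{y \<in> set ws. E x y}. card (branch E x y)) + 1 =
        card (branch E u x) * (N - 1)"
      unfolding card N by simp
    ultimately show "runs (step E) (\<lambda>s. hd s \<in> branch E u x) (card (branch E u x) * (N - 1))
        (x # ws @ [u]) (u # ws @ [x])"
      by (simp only:)
  qed
qed

lemma excursion_neighbour:
  assumes "u \<in> T" "E u x"
  shows "excursion E V x u (branch E u x)"
proof (cases "x \<in> K")
  case True
  then show ?thesis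
    using bridge[of u x] assms excursion_complete branch_complete by simp
next
  case False
  then have "x \<in> T" using E_V[OF assms(2)] V_eq by auto
  moreover have "E x u" using assms(2) E_commute by simp
  ultimately show ?thesis by (rule excursion_branch)
qed

text \<open>The initial state can recur only when \<open>u\<close> is carried and faces
  \<open>z\<close>. After the first step this is excluded: if \<open>z\<close> is a neighbour, its
  branch is toured with other vertices carried; then, whenever \<open>u\<close> is carried, it faces
  an entry of \<open>zs\<close>, until the sweep closes.\<close>

lemma first_return:
  assumes d: "distinct (u # ws)" and s: "set (u # ws) = V" and u: "u \<in> T"
  shows "(step E ^^ (N * (N - 1))) (u # ws) = u # ws"
    and "\<And>t. 0 < t \<Longrightarrow> t < N * (N - 1) \<Longrightarrow> (step E ^^ t) (u # ws) \<noteq> u # ws"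
proof -
  have "v1 \<in> set (u # ws)" "v2 \<in> set (u # ws)" "v1 \<noteq> v2"
    using s v1 v2 V_eq disjoint by auto
  then obtain z zs where ws: "ws = z # zs" by (cases ws) auto
  let ?B = "branch E u"
  let ?Q = "\<lambda>s. hd s = u \<longrightarrow> s ! 1 \<noteq> z"
  let ?n = "if E u z then card (?B z) * (N - 1) else 0"
  let ?S = "\<Sum>x\<in>{x \<in> set zs. E u x}. card (?B x)"
  have ex: "excursion E V x u (?B x)" if "E u x" for x
    using excursion_neighbour u that by blast
  have first: "runs (step E) ?Q ?n (step E (u # ws)) (u # zs @ [z])"
  proof (cases "E u z")
    case True
    have "runs (step E) (\<lambda>s. hd s \<in> ?B z) (card (?B z) * (N - 1)) (z # zs @ [u]) (u # zs @ [z])"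
      using ex[OF True] d s ws unfolding excursion_def by auto
    then show ?thesis
      using True ex[OF True] by (auto simp: ws excursion_def intro: runs_mono)
  next
    case False
    then show ?thesis by (simp add: ws runs_0)
  qed
  have "runs (step E)
      (\<lambda>s. hd s \<in> insert u (\<Union>x\<in>{x \<in> set zs. E u x}. ?B x) \<and> (hd s = u \<longrightarrow> s ! 1 \<in> set zs))
      (length zs + (N - 1) * ?S) (u # zs @ [z]) (u # [z] @ zs)"
    by (rule sweep) (use d s ws ex in auto)
  then have "runs (step E) ?Q (length zs + (N - 1) * ?S) (u # zs @ [z]) (u # ws)"
    unfolding ws append_Cons append_Nil by (rule runs_mono) (use d ws in auto)
  with first have run: "runs (step E) ?Q (?n + (length zs + (N - 1) * ?S)) (step E (u # ws)) (u # ws)"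
    by (rule runs_trans)
  have len: "N - 1 = Suc (length zs)" using length_eq[OF d s] ws by simp
  \<comment> \<open>The branches at \<open>u\<close> partition the other vertices, so their sizes
    sum to N - 1.\<close>
  have "N = Suc (\<Sum>y\<in>{y. E u y}. card (?B y))"
    using card_branches[OF u, of "\<lambda>_. True"] V_decompose[OF u] by simp
  also have "{y. E u y} = {x \<in> set ws. E u x}" using s E_V E_irrefl by fastforce
  also have "(\<Sum>y\<in>{x \<in> set ws. E u x}. card (?B y)) = (if E u z then card (?B z) else 0) + ?S"
  proof (cases "E u z")
    case True
    then have "{x \<in> set ws. E u x} = insert z {x \<in> set zs. E u x}" using ws by auto
    moreover have "z \<notin> {x \<in> set zs. E u x}" using d ws by auto
    ultimately show ?thesis using True by simp
  next
    case False
    then have "{x \<in> set ws. E u x} = {x \<in> set zs. E u x}" using ws by auto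
    then show ?thesis using False by simp
  qed
  finally have "N * (N - 1) = Suc ((if E u z then card (?B z) else 0) + ?S) * (N - 1)"
    by (rule arg_cong)
  also have "\<dots> = Suc (?n + (length zs + (N - 1) * ?S))"
    unfolding len by (simp add: algebra_simps)
  finally have total: "N * (N - 1) = Suc (?n + (length zs + (N - 1) * ?S))" .
  show "(step E ^^ (N * (N - 1))) (u # ws) = u # ws"
    using run unfolding total by (simp add: runs_def funpow_swap1)
  fix t assume t: "0 < t" "t < N * (N - 1)"
  then obtain t' where t': "t = Suc t'" by (cases t) auto
  then have "?Q ((step E ^^ t) (u # ws))"
    using run t(2) unfolding total by (simp add: runs_def funpow_swap1)
  then show "(step E ^^ t) (u # ws) \<noteq> u # ws" using ws by auto
qed

end


section \<open>Bridge sums and toric promotion\<close>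

abbreviation adj :: "'a graph \<Rightarrow> 'a \<Rightarrow> 'a \<Rightarrow> bool" where
  "adj G x y \<equiv> {x, y} \<in> edges G"

section \<open>Bridge sums as instances of the locale\<close>

text \<open>A path from \<open>y\<close> to \<open>z\<close> avoiding \<open>x\<close> would close
  up through \<open>x\<close> to a cycle.\<close>

lemma tree_separating:
  assumes T: "is_tree T" and xy: "adj T x y" and xz: "adj T x z" and yz: "y \<noteq> z"
  shows "z \<notin> branch (adj T) x y"
proof
  assume "z \<in> branch (adj T) x y"
  then have "(\<lambda>a b. (a, b) \<in> avoiding (adj T) x)\<^sup>*\<^sup>* y z"
    by (simp add: branch_def rtranclp_rtrancl_eq)
  then obtain xs where path: "rtrancl_path (\<lambda>a b. (a, b) \<in> avoiding (adj T) x) y xs z"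
      and dist: "distinct (y # xs)"
    by (meson rtranclp_eq_rtrancl_path rtrancl_path_distinct)
  have simple: "simple_graph T" using T by (simp add: is_tree_def)
  have ne: "xs \<noteq> []" using path yz by (auto elim: rtrancl_path.cases)
  have last: "last xs = z" using path ne by (rule rtrancl_path_last)
  have edge: "adj T ((y # xs) ! k) (xs ! k)" "xs ! k \<noteq> x" if "k < length xs" for k
    using rtrancl_path_nth[OF path that] by (auto simp: avoiding_def)
  have verts: "a \<in> verts T" "b \<in> verts T" "a \<noteq> b" if "adj T a b" for a b
    using simple that by (force simp: simple_graph_def)+
  have "set xs \<subseteq> verts T" "x \<notin> set xs"
    using edge(2) verts(2)[OF edge(1)] by (auto simp: in_set_conv_nth)
  moreover have "adj T ((x # y # xs) ! k) ((x # y # xs) ! (Suc k mod length (x # y # xs)))"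
    if k: "k < length (x # y # xs)" for k
  \<comment> \<open>The last index gives the closing edge from \<open>z\<close> to \<open>x\<close>,
    where \<open>mod\<close> wraps to 0; index 0 gives the edge from \<open>x\<close> to
    \<open>y\<close>, and the others lie on the path.\<close>
  proof (cases "k = Suc (length xs)")
    case True
    then have "(x # y # xs) ! k = z" using ne last by (simp add: last_conv_nth nth_Cons')
    then show ?thesis using True xz by (simp add: insert_commute)
  next
    case False
    then show ?thesis using k xy edge(1)[of "k - 1"] by (cases k) auto
  qed
  ultimately have "is_cycle T (x # y # xs)"
    using dist ne verts[OF xy] unfolding is_cycle_def by (cases xs) auto
  then show False using T by (auto simp: is_tree_def)
qed

lemma bridge_walk_bridge_sum:
  assumes T: "is_tree T" and K: "is_complete K" and disj: "verts T \<inter> verts K = {}"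
    and v1: "v1 \<in> verts T" and v2: "v2 \<in> verts K"
  shows "bridge_walk (adj (bridge_sum T K v1 v2)) (verts (bridge_sum T K v1 v2)) (verts T) (verts K) v1 v2"
proof -
  define G where "G = bridge_sum T K v1 v2"
  have simT: "simple_graph T" and simK: "simple_graph K"
    using T K by (auto simp: is_tree_def is_complete_def)
  have simG: "simple_graph G"
    unfolding G_def using simT simK disj v1 v2 by (rule bridge_sum_simple_graph)
  have V: "verts G = verts T \<union> verts K" by (simp add: G_def bridge_sum_def)
  have E: "adj G x y \<longleftrightarrow> adj T x y \<or> adj K x y \<or> {x, y} = {v1, v2}" for x y
    by (auto simp: G_def bridge_sum_def)
  have ET: "x \<in> verts T" "y \<in> verts T" if "adj T x y" for x y
    using simT that by (auto simp: simple_graph_def)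
  have EK: "x \<in> verts K" "y \<in> verts K" if "adj K x y" for x y
    using simK that by (auto simp: simple_graph_def)
  have EG: "x \<in> verts G" "y \<in> verts G" if "adj G x y" for x y
    using simG that by (auto simp: simple_graph_def)
  have sym: "symp (adj G)" by (simp add: symp_def insert_commute)
  have bridge: "adj G x y \<longleftrightarrow> x = v1 \<and> y = v2" if "x \<in> verts T" "y \<in> verts K" for x y
    using that disj v1 v2 ET[of x y] EK[of x y] unfolding E by (auto simp: doubleton_eq_iff)
  have inT: "adj G x y \<longleftrightarrow> adj T x y" if "x \<in> verts T" "y \<in> verts T" for x y
    using that disj v2 EK[of x y] unfolding E by (auto simp: doubleton_eq_iff)
  \<comment> \<open>A walk can leave the tree only at \<open>v1\<close>. Remembering
    \<open>v1\<close> while the walk is in \<open>K\<close> yields a walk inside the tree once it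
    comes back, and \<open>x\<close> is not \<open>v1\<close> because the walk avoids
    \<open>x\<close>.\<close>
  have walk: "(w \<in> verts T \<longrightarrow> w \<in> branch (adj T) x y) \<and>
      (w \<in> verts K \<longrightarrow> x \<noteq> v1 \<and> v1 \<in> branch (adj T) x y)"
    if "w \<in> branch (adj G) x y" "y \<in> verts T" for x y w
    using that(1)
  proof (induction rule: branch_induct)
    case base
    then show ?case using that(2) disj branch_self[of y "adj T" x] by auto
  next
    case (step a b)
    have "b \<in> branch (adj T) x y" if "a \<in> verts T" "b \<in> verts T"
      using step that inT branch_step[of a "adj T" x y b] by simp
    moreover have "a = v1" if "a \<in> verts T" "b \<in> verts K"
      using step that bridge by simp
    moreover have "b = v1" if "b \<in> verts T" "a \<in> verts K"
      using step that bridge[of b a] by (simp add: insert_commute)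
    moreover have "a \<in> verts T \<or> a \<in> verts K" "b \<in> verts T \<or> b \<in> verts K"
      using EG[OF \<open>adj G a b\<close>] V by auto
    ultimately show ?case using step disj by blast
  qed
  have separating: "z \<notin> branch (adj G) x y"
    if x: "x \<in> verts T" and xy: "adj G x y" and xz: "adj G x z" and yz: "y \<noteq> z" for x y z
  proof
    assume z: "z \<in> branch (adj G) x y"
    have mem: "y \<in> verts T \<or> y \<in> verts K" "z \<in> verts T \<or> z \<in> verts K"
      using EG[OF xy] EG[OF xz] V by auto
    show False
    \<comment> \<open>Two neighbours in the tree reduce to \<open>tree_separating\<close>. A
      neighbour in \<open>K\<close> forces \<open>x = v1\<close>, contrary to \<open>walk\<close>;
      if that neighbour is \<open>y\<close>, symmetry of branches lets the walk start at
      \<open>z\<close> instead.\<close>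
    proof (cases "y \<in> verts T")
      case True
      show False
      proof (cases "z \<in> verts T")
        case zT: True
        then show False
          using tree_separating[OF T, of x y z] walk[OF z True] True x xy xz yz inT by blast
      next
        case False
        then show False using walk[OF z True] mem bridge[OF x, of z] xz by blast
      qed
    next
      case False
      then have y: "x = v1" "y = v2" using bridge[OF x, of y] xy mem by auto
      then have zT: "z \<in> verts T" using bridge[OF x, of z] xz yz mem by auto
      have "y \<in> branch (adj G) x z"
        using branch_sym[OF sym z] branch_self[of y "adj G" x] by simp
      then show False using walk[of y x z] zT v2 y by blast
    qed
  qed
  have compK: "adj G x y" if "x \<in> verts K" "y \<in> verts K" "x \<noteq> y" for x y
    using K that unfolding E is_complete_def by blast
  have to_v1: "(adj G)\<^sup>*\<^sup>* v1 x" if "x \<in> verts G" for x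
  proof (cases "x \<in> verts T")
    case True
    have "(v1, x) \<in> {(x, y). {x, y} \<in> edges T}\<^sup>*"
      using T True v1 by (auto simp: is_tree_def connected_graph_def)
    moreover have "{(x, y). {x, y} \<in> edges T} \<subseteq> {(x, y). adj G x y}" by (auto simp: E)
    ultimately have "(v1, x) \<in> {(x, y). adj G x y}\<^sup>*" using rtrancl_mono by blast
    then show ?thesis by (simp add: rtranclp_rtrancl_eq[symmetric])
  next
    case False
    then have "x \<in> verts K" using that V by auto
    moreover have "adj G v1 v2" by (simp add: E)
    ultimately show ?thesis
      using compK[OF v2, of x] by (cases "x = v2") (auto intro: converse_rtranclp_into_rtranclp)
  qed
  show ?thesis
    unfolding G_def[symmetric]
  proof
    show "finite (verts G)" using simG by (simp add: simple_graph_def)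
    show "\<not> adj G x x" for x using simG by (auto simp: simple_graph_def)
    show "x \<in> verts G \<and> y \<in> verts G" if "adj G x y" for x y
      using EG[OF that] by simp
    show "(adj G)\<^sup>*\<^sup>* x y" if "x \<in> verts G" "y \<in> verts G" for x y
      using sympD[OF symp_rtranclp[OF sym] to_v1[OF that(1)]] to_v1[OF that(2)]
      by (rule rtranclp_trans)
  qed (use V disj v1 v2 sym compK bridge separating in auto)
qed

section \<open>States as cyclic lists\<close>

definition reading :: "'a graph \<Rightarrow> ('a \<Rightarrow> nat) \<times> nat \<Rightarrow> 'a list" where
  "reading G = (\<lambda>(\<sigma>, i). map
     (\<lambda>k. inv_into (verts G) \<sigma> ((cyc_succ (card (verts G)) ^^ k) i)) [0..<card (verts G)])"

lemma cyc_succ_funpow: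
  assumes "i \<in> {1..N}"
  shows "(cyc_succ N ^^ k) i = (i - 1 + k) mod N + 1"
proof (induction k)
  case 0
  then show ?case using assms by auto
next
  case (Suc k)
  then show ?case by (simp add: cyc_succ_def mod_Suc_eq)
qed

lemma cyc_succ_period:
  assumes "i \<in> {1..N}" "N dvd k"
  shows "(cyc_succ N ^^ k) i = i"
proof -
  obtain q where "k = N * q" using assms(2) by (auto simp: dvd_def)
  then have "(i - 1 + k) mod N = (i - 1) mod N" by simp
  also have "\<dots> = i - 1" using assms(1) by (intro mod_less) auto
  finally show ?thesis using assms(1) cyc_succ_funpow by simp
qed

lemma inj_on_cyc_succ_funpow:
  assumes "i \<in> {1..N}"
  shows "inj_on (\<lambda>k. (cyc_succ N ^^ k) i) {..<N}"
proof (rule linorder_inj_onI)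
  fix k l assume "k < l" "k \<in> {..<N}" "l \<in> {..<N}"
  then have "\<not> N dvd (i - 1 + l) - (i - 1 + k)" by (auto dest: dvd_imp_le)
  then show "(cyc_succ N ^^ k) i \<noteq> (cyc_succ N ^^ l) i"
    using \<open>k < l\<close> mod_eq_dvd_iff_nat[of "i - 1 + k" "i - 1 + l" N]
    unfolding cyc_succ_funpow[OF assms] by auto
qed auto

lemma bij_betw_cyc_succ_funpow:
  assumes "i \<in> {1..N}"
  shows "bij_betw (\<lambda>k. (cyc_succ N ^^ k) i) {..<N} {1..N}"
proof -
  have "(\<lambda>k. (cyc_succ N ^^ k) i) ` {..<N} \<subseteq> {1..N}"
    unfolding cyc_succ_funpow[OF assms] using assms by (auto simp: Suc_le_eq)
  moreover have "card ((\<lambda>k. (cyc_succ N ^^ k) i) ` {..<N}) = card {1..N}"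
    using card_image[OF inj_on_cyc_succ_funpow[OF assms]] by simp
  ultimately show ?thesis
    using inj_on_cyc_succ_funpow[OF assms] card_subset_eq[of "{1..N}"] by (auto simp: bij_betw_def)
qed

lemma bij_betw_reading:
  assumes "(\<sigma>, i) \<in> states G"
  shows "bij_betw (\<lambda>k. inv_into (verts G) \<sigma> ((cyc_succ (card (verts G)) ^^ k) i))
    {..<card (verts G)} (verts G)"
proof -
  have "bij_betw (inv_into (verts G) \<sigma>) {1..card (verts G)} (verts G)"
    using assms by (auto simp: states_def labelings_def intro: bij_betw_inv_into)
  from bij_betw_trans[OF bij_betw_cyc_succ_funpow this] show ?thesis
    using assms by (simp add: states_def o_def)
qed

lemma distinct_reading: "s \<in> states G \<Longrightarrow> distinct (reading G s)"
  using bij_betw_reading[of "fst s" "snd s" G]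
  by (auto simp: reading_def distinct_map bij_betw_def lessThan_atLeast0 split_beta)

lemma set_reading: "s \<in> states G \<Longrightarrow> set (reading G s) = verts G"
  using bij_betw_reading[of "fst s" "snd s" G]
  by (simp add: reading_def bij_betw_def lessThan_atLeast0 split_beta)

lemma inv_into_compose_transpose_apply:
  assumes "\<sigma> \<in> labelings G" "i \<in> {1..card (verts G)}" "j \<in> {1..card (verts G)}"
    and "l \<in> {1..card (verts G)}"
  shows "inv_into (verts G) (compose (verts G) (transpose i j) \<sigma>) l = inv_into (verts G) \<sigma> (transpose i j l)"
proof (rule inv_into_f_eq)
  show "inj_on (compose (verts G) (transpose i j) \<sigma>) (verts G)"
    using compose_transpose_labelings[OF assms(1-3)] by (auto simp: labelings_def bij_betw_def)
  have im: "transpose i j l \<in> \<sigma> ` verts G"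
    using assms by (auto simp: labelings_def bij_betw_def transpose_def)
  then show "inv_into (verts G) \<sigma> (transpose i j l) \<in> verts G"
    by (rule inv_into_into)
  then show "compose (verts G) (transpose i j) \<sigma> (inv_into (verts G) \<sigma> (transpose i j l)) = l"
    using im by (simp add: compose_def f_inv_into_f)
qed

text \<open>Both states have the same \<open>i\<close> because the list alone does not determine the
  state: shifting all labels and \<open>i\<close> together leaves it unchanged.\<close>

lemma reading_inject:
  assumes s: "(\<sigma>, i) \<in> states G" and t: "(\<tau>, i) \<in> states G"
    and eq: "reading G (\<sigma>, i) = reading G (\<tau>, i)"
  shows "\<sigma> = \<tau>"
proof (rule extensionalityI)
  show "\<sigma> \<in> extensional (verts G)" "\<tau> \<in> extensional (verts G)"
    using s t by (auto simp: states_def labelings_def)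
  fix x assume x: "x \<in> verts G"
  let ?N = "card (verts G)"
  have bij: "bij_betw \<sigma> (verts G) {1..?N}" "bij_betw \<tau> (verts G) {1..?N}" and i: "i \<in> {1..?N}"
    using s t by (auto simp: states_def labelings_def)
  have "\<sigma> x \<in> {1..?N}" using bij x by (auto simp: bij_betw_def)
  then obtain k where k: "k < ?N" "\<sigma> x = (cyc_succ ?N ^^ k) i"
    using bij_betw_imp_surj_on[OF bij_betw_cyc_succ_funpow[OF i]] by blast
  have "inv_into (verts G) \<sigma> (\<sigma> x) = inv_into (verts G) \<tau> (\<sigma> x)"
    using arg_cong[OF eq, of "\<lambda>xs. xs ! k"] k by (simp add: reading_def)
  moreover have "inv_into (verts G) \<sigma> (\<sigma> x) = x"
    using bij(1) x by (simp add: bij_betw_inv_into_left)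
  moreover have "\<tau> (inv_into (verts G) \<tau> (\<sigma> x)) = \<sigma> x"
    using bij(2) \<open>\<sigma> x \<in> _\<close> by (simp add: bij_betw_inv_into_right)
  ultimately show "\<sigma> x = \<tau> x" by simp
qed

lemma snd_TPro: "snd (TPro G s) = cyc_succ (card (verts G)) (snd s)"
  by (simp add: TPro_def Let_def split: prod.splits)

text \<open>The new reading starts at i + 1. With an edge nothing is relabelled, so the list
  rotates; otherwise the old head has received label i + 1 and stays first, while the entry after it
  has received label i and is read last.\<close>

lemma reading_TPro:
  assumes s: "s \<in> states G" and N: "2 \<le> card (verts G)"
  shows "reading G (TPro G s) = step (adj G) (reading G s)"
proof -
  let ?N = "card (verts G)" and ?V = "verts G"
  obtain \<sigma> i where si: "s = (\<sigma>, i)" by (cases s)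
  define c where "c k = (cyc_succ ?N ^^ k) i" for k
  define p where "p k = inv_into ?V \<sigma> (c k)" for k
  have i: "i \<in> {1..?N}" and \<sigma>: "\<sigma> \<in> labelings G" using s si by (auto simp: states_def)
  have c_mem: "c k \<in> {1..?N}" for k
    unfolding c_def by (induction k) (use i cyc_succ_mem in auto)
  have c_inj: "c k = c l \<longleftrightarrow> k = l" if "k < ?N" "l < ?N" for k l
    using inj_on_eq_iff[OF inj_on_cyc_succ_funpow[OF i]] that by (simp add: c_def)
  have c_N: "c ?N = c 0" using cyc_succ_period[OF i dvd_refl] by (simp add: c_def)
  have c_last: "c (Suc (Suc k)) = c 0" if "Suc k < ?N" "\<not> k < ?N - 2" for k
  proof -
    have "Suc (Suc k) = ?N" using that by simp
    then show ?thesis using c_N by simp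
  qed
  have c_Suc: "(cyc_succ ?N ^^ k) (c (Suc 0)) = c (Suc k)" for k
    by (simp add: c_def funpow_swap1)
  have upt: "[0..<?N] = 0 # Suc 0 # [2..<?N]"
    using N by (simp add: upt_conv_Cons numeral_2_eq_2)
  have read: "reading G s = p 0 # p (Suc 0) # map p [2..<?N]"
    unfolding si reading_def prod.case upt by (simp add: p_def c_def)
  show ?thesis
  proof (cases "adj G (p 0) (p (Suc 0))")
    case True
    then have "TPro G s = (\<sigma>, c (Suc 0))"
      by (simp add: si TPro_def Let_def p_def c_def)
    then have "reading G (TPro G s) = map (\<lambda>k. p (Suc k)) [0..<?N]"
      by (simp add: reading_def c_Suc p_def)
    also have "\<dots> = p (Suc 0) # map p [2..<?N] @ [p 0]"
      using N c_last by (intro nth_equalityI) (auto simp: nth_Cons nth_append p_def split: nat.splits)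
    finally show ?thesis using True by (simp add: read)
  next
    case False
    let ?\<tau> = "compose ?V (transpose (c 0) (c (Suc 0))) \<sigma>"
    have "TPro G s = (?\<tau>, c (Suc 0))"
      using False by (simp add: si TPro_def Let_def p_def c_def)
    then have "reading G (TPro G s) =
        map (\<lambda>k. inv_into ?V \<sigma> (transpose (c 0) (c (Suc 0)) (c (Suc k)))) [0..<?N]"
      by (simp add: reading_def c_Suc inv_into_compose_transpose_apply[OF \<sigma> c_mem c_mem c_mem])
    also have "\<dots> = p 0 # map p [2..<?N] @ [p (Suc 0)]"
    proof (rule nth_equalityI)
      fix k assume "k < length (map (\<lambda>k. inv_into ?V \<sigma> (transpose (c 0) (c (Suc 0)) (c (Suc k)))) [0..<?N])"
      then have k: "k < ?N" by simp
      \<comment> \<open>At k = 0 the label i + 1 is transposed to i; at the last position the label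
        has wrapped round to i and is transposed to i + 1; the other labels are fixed.\<close>
      consider "k = 0" | "k = ?N - 1" "k \<noteq> 0" | "k \<noteq> 0" "Suc k < ?N" using k by linarith
      then show "map (\<lambda>k. inv_into ?V \<sigma> (transpose (c 0) (c (Suc 0)) (c (Suc k)))) [0..<?N] ! k =
          (p 0 # map p [2..<?N] @ [p (Suc 0)]) ! k"
      proof cases
        case 1
        then show ?thesis using k by (simp add: p_def)
      next
        case 2
        then have "c (Suc k) = c 0" using c_N k by simp
        then show ?thesis using 2 k by (auto simp: p_def nth_Cons nth_append split: nat.splits)
      next
        case 3
        then have "c (Suc k) \<noteq> c 0" "c (Suc k) \<noteq> c (Suc 0)" using c_inj k N by auto
        then show ?thesis using 3 k by (auto simp: p_def nth_Cons nth_append split: nat.splits)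
      qed
    qed (use N in simp)
    finally show ?thesis using False by (simp add: read)
  qed
qed

section \<open>Orbit lengths\<close>

text \<open>Powers of \<open>f\<close> commute and are injective on \<open>A\<close>, so both points
  have the same periods.\<close>

lemma orbit_length_funpow:
  assumes "bij_betw f A A" "x \<in> A"
  shows "orbit_length f ((f ^^ t) x) = orbit_length f x"
proof -
  have bij: "bij_betw (f ^^ n) A A" for n using assms(1) by (rule bij_betw_funpow)
  have "(f ^^ L) ((f ^^ t) x) = (f ^^ t) x \<longleftrightarrow> (f ^^ L) x = x" for L
  proof -
    have "(f ^^ L) ((f ^^ t) x) = (f ^^ t) ((f ^^ L) x)"
      by (metis add.commute comp_apply funpow_add)
    moreover have "(f ^^ L) x \<in> A" using bij_betwE[OF bij] assms(2) by blast
    ultimately show ?thesis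
      using inj_on_eq_iff[OF bij_betw_imp_inj_on[OF bij]] assms(2) by metis
  qed
  then show ?thesis by (simp add: orbit_length_def)
qed

theorem theorem8:
  fixes T K G :: "'a graph" and m n :: nat and v1 v2 :: 'a
  assumes "m \<ge> 1" and "n \<ge> 1"
    and "is_tree T" and "card (verts T) = m"
    and "is_complete K" and "card (verts K) = n"
    and "verts T \<inter> verts K = {}"
    and "v1 \<in> verts T" and "v2 \<in> verts K"
    and "G = bridge_sum T K v1 v2"
  shows "\<forall>s\<in>states G. orbit_length (TPro G) s = (m + n) * (m + n - 1)"
proof
  interpret bridge_walk "adj G" "verts G" "verts T" "verts K" v1 v2
    unfolding assms(10) using assms by (intro bridge_walk_bridge_sum)
  have N: "card (verts G) = m + n"
    using assms finite_V unfolding V_eq by (subst card_Un_disjoint) auto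
  have N2: "2 \<le> card (verts G)" using N assms(1,2) by simp
  have simple: "simple_graph G"
    using assms by (auto simp: is_tree_def is_complete_def intro: bridge_sum_simple_graph)
  note bij = TPro_bij_betw[OF simple]
  have closed: "(TPro G ^^ t) s \<in> states G" if "s \<in> states G" for t s
    using bij_betwE[OF bij_betw_funpow[OF bij]] that by blast
  have read: "reading G ((TPro G ^^ t) s) = (step (adj G) ^^ t) (reading G s)" if "s \<in> states G" for t s
    by (induction t) (use closed[OF that] reading_TPro[OF _ N2] in auto)
  have snd: "snd ((TPro G ^^ t) s) = (cyc_succ (m + n) ^^ t) (snd s)" for t s
    by (induction t) (auto simp: snd_TPro N)
  have ne: "reading G s \<noteq> []" if "s \<in> states G" for s
    using set_reading[OF that] assms(8) V_eq by auto
  have main: "orbit_length (TPro G) s = (m + n) * (m + n - 1)"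
    if s: "s \<in> states G" and hd: "hd (reading G s) \<in> verts T" for s
  proof -
    obtain u ws where uws: "reading G s = u # ws" using ne[OF s] by (cases "reading G s") auto
    have d: "distinct (u # ws)" "set (u # ws) = verts G" "u \<in> verts T"
      using distinct_reading[OF s] set_reading[OF s] hd uws by auto
    let ?L = "(m + n) * (m + n - 1)"
    have "snd s \<in> {1..m + n}" using s N by (auto simp: states_def)
    \<comment> \<open>N divides \<open>?L\<close>, so the label returns along with the list, and
      together they determine the state.\<close>
    then have "snd ((TPro G ^^ ?L) s) = snd s"
      by (simp add: snd cyc_succ_period)
    moreover have "reading G ((TPro G ^^ ?L) s) = reading G s"
      using first_return(1)[OF d] read[OF s] uws N by simp
    ultimately have "(TPro G ^^ ?L) s = s"
      using reading_inject closed[OF s] s by (metis prod.collapse)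
    moreover have "1 \<le> ?L" using assms(1,2) by (simp add: Suc_le_eq)
    moreover have "?L \<le> t" if "1 \<le> t \<and> (TPro G ^^ t) s = s" for t
      using first_return(2)[OF d, of t] read[OF s, of t] uws N that by (cases "t < ?L") auto
    ultimately show ?thesis
      unfolding orbit_length_def by (intro Least_equality) auto
  qed
  fix s assume s: "s \<in> states G"
  \<comment> \<open>All states of an orbit share its length, so it is enough to find one whose
    carried vertex lies in the tree.\<close>
  have "\<exists>t. hd (reading G ((TPro G ^^ t) s)) \<in> verts T"
  proof (cases "hd (reading G s) \<in> verts T")
    case True
    then show ?thesis by (intro exI[of _ 0]) simp
  next
    case False
    obtain u ws where uws: "reading G s = u # ws" using ne[OF s] by (cases "reading G s") auto
    have "\<exists>t. hd ((step (adj G) ^^ t) (u # ws)) = v1"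
      using distinct_reading[OF s] set_reading[OF s] False uws V_eq by (intro reaches_v1) auto
    then show ?thesis using read[OF s] uws assms(8) by auto
  qed
  then show "orbit_length (TPro G) s = (m + n) * (m + n - 1)"
    using main closed[OF s] orbit_length_funpow[OF bij s] by metis
qed

end
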